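(* Let $\alpha>0$ and $\beta\in\mathbb R$. If $1\le p_1\le p_2\le\infty$ and $1\le q_1\le q_2\le\infty$, then $$M^{p_1,q_1}_{\alpha,\beta}\hookrightarrow M^{p_2,q_2}_{\alpha,\beta}$$ continuously.
   Context: Conventions: $\widehat f(\eta)=\int_{\mathbb R^d}f(t)e^{-it\cdot\eta}\,dt$; $\langle f,g\rangle=\int f\overline g$, extended to a sesquilinear pairing of $\mathcal S'$ with $\mathcal S$; $B(c,r)$ is a Euclidean ball. Subdyadic lattice at scale $\rho\in(0,\rho_0]$. Here $\rho_0,a>0$ are fixed sufficiently small constants and $b>0$ a fixed constant, depending only on $d,\alpha$. For $n\in\mathbb N_0$ let $A_n=\{2^n\le|\xi|<2^{n+1}\}$, $h_n=\rho2^{n(1-\alpha)}$. Partition $\mathbb R^d$ into half-open cubes of side $h_n$ and choose one point of $A_n$ in each cube meeting $A_n$ (candidates). Order all candidates first by $n$ and arbitrarily inside each annulus, and process them in this order, retaining a candidate $\xi$ exactly when the ball $\{|\eta-\xi|<a\rho|\xi|^{1-\alpha}\}$ is disjoint from all such balls of previously retained candidates. Enumerate the retained points as $\{\xi_k\}_{k\in\mathbb N}$ and set $x_j^k=b\rho|\xi_k|^{\alpha-1}j$, $j\in\mathbb Z^d$; $\Omega_\alpha=\{(x_j^k,\xi_k)\}$. There is a constant $A_{\mathrm{cov}}>1$ depending only on $d,\alpha$ such that the balls $\{|\eta-\xi_k|\le A_{\mathrm{cov}}\rho|\xi_k|^{1-\alpha}\}$ cover $\{|\eta|\ge1\}$.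 A subdyadic frame pair $(\phi,\Omega_\alpha)$ is fixed: $\phi\in\mathcal S(\mathbb R^d)$ is real-valued, even, $L^2$-normalized, with $\widehat\phi\in C_c^\infty$, $\operatorname{supp}\widehat\phi\subset B(0,R_1)$, $|\widehat\phi|\ge m_0>0$ on $\{|\zeta|\le R_0\}$, where $3\cdot2^{\max\{\alpha-1,0\}}<R_0<R_1$; and $\Omega_\alpha$ is a subdyadic lattice at a scale $\rho_\ast\le\rho_0$, i.e. $\Omega_\alpha=\{(x_j^k,\xi_k):k\in\mathbb N,\ j\in\mathbb Z^d\}$ where the $\xi_k$ are the centers retained by the selection procedure run with $\rho=\rho_\ast$ and $x_j^k=b\rho_\ast|\xi_k|^{\alpha-1}j$, with $A_{\mathrm{cov}}\rho_\ast<R_0$ and $b\rho_\ast R_1<\pi$. Packets: $\phi_{x,\xi}(t)=|\xi|^{\frac d2(1-\alpha)}\phi((t-x)|\xi|^{1-\alpha})e^{it\cdot\xi}$. For $f\in\mathcal S'(\mathbb R^d)$ put $c_{j,k}(f)=\langle f,\phi_{x_j^k,\xi_k}\rangle$. For $1\le p,q\le\infty$, $M^{p,q}_{\alpha,\beta}$ is the set of $f\in\mathcal S'(\mathbb R^d)$ with $\|f\|_{M^{p,q}_{\alpha,\beta}}=\big(\sum_k(\sum_j|c_{j,k}(f)|^p)^{q/p}(1+|\xi_k|)^{\beta q}\big)^{1/q}<\infty$ (suprema if $p$ or $q$ is infinite). *)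

theory Defs
  imports "HOL-Analysis.Analysis"
begin

section \<open>Schwartz functions and tempered distributions\<close>

primrec iter_partial ::
    "'n list \<Rightarrow> (real ^ 'n \<Rightarrow> complex) \<Rightarrow> real ^ 'n \<Rightarrow> complex" where
  "iter_partial [] f = f"
| "iter_partial (i # is) f = (\<lambda>x. frechet_derivative (iter_partial is f) (at x) (axis i 1))"

definition smooth :: "(real ^ 'n \<Rightarrow> complex) \<Rightarrow> bool" where
  "smooth f \<longleftrightarrow> (\<forall>is x. iter_partial is f differentiable (at x))"

definition schwartz :: "(real ^ 'n \<Rightarrow> complex) \<Rightarrow> bool" where
  "schwartz f \<longleftrightarrow> smooth f \<and>
     (\<forall>m is. bounded (range (\<lambda>x. (1 + norm x) ^ m *\<^sub>R iter_partial is f x)))"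

definition schwartz_seminorm ::
    "nat \<Rightarrow> 'n list \<Rightarrow> (real ^ 'n \<Rightarrow> complex) \<Rightarrow> real" where
  "schwartz_seminorm m is f = (SUP x. (1 + norm x) ^ m * cmod (iter_partial is f x))"

definition schwartz_topology :: "(real ^ 'n \<Rightarrow> complex) topology" where
  "schwartz_topology = topology_generated_by
     {{g. schwartz g \<and> schwartz_seminorm m is (\<lambda>x. g x - f x) < e} | f m is e.
        schwartz f \<and> 0 < e}"

text \<open>
  Distributions are complex-linear functionals on the Schwartz space. The value 0 outside
  that space is a normalization, so that equal distributions are equal functions.
\<close>

definition tempered_distribution :: "((real ^ 'n \<Rightarrow> complex) \<Rightarrow> complex) \<Rightarrow> bool" where
  "tempered_distribution u \<longleftrightarrow>
     (\<forall>f g. schwartz f \<longrightarrow> schwartz g \<longrightarrow> u (\<lambda>x. f x + g x) = u f + u g) \<and>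
     (\<forall>c f. schwartz f \<longrightarrow> u (\<lambda>x. c * f x) = c * u f) \<and>
     continuous_map schwartz_topology euclidean u \<and>
     (\<forall>f. \<not> schwartz f \<longrightarrow> u f = 0)"

text \<open>The conjugate makes this extend \<open>\<integral> f(t) \<cdot> cnj (g(t)) dt\<close>, conjugate-linear in \<open>g\<close>.\<close>

definition distr_pairing ::
    "((real ^ 'n \<Rightarrow> complex) \<Rightarrow> complex) \<Rightarrow> (real ^ 'n \<Rightarrow> complex) \<Rightarrow> complex" where
  "distr_pairing u g = u (\<lambda>t. cnj (g t))"

definition fourier :: "(real ^ 'n \<Rightarrow> complex) \<Rightarrow> real ^ 'n \<Rightarrow> complex" where
  "fourier f \<eta> = (LINT t|lborel. f t * exp (- \<i> * complex_of_real (t \<bullet> \<eta>)))"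

definition support :: "(real ^ 'n \<Rightarrow> complex) \<Rightarrow> (real ^ 'n) set" where
  "support f = closure {x. f x \<noteq> 0}"


section \<open>Subdyadic lattices\<close>

definition annulus :: "nat \<Rightarrow> (real ^ 'n) set" where
  "annulus n = {\<xi>. 2 ^ n \<le> norm \<xi> \<and> norm \<xi> < 2 ^ (n + 1)}"

definition cube_side :: "real \<Rightarrow> real \<Rightarrow> nat \<Rightarrow> real" where
  "cube_side \<alpha> \<rho> n = \<rho> * 2 powr (real n * (1 - \<alpha>))"

definition half_open_cube :: "real ^ 'n \<Rightarrow> real \<Rightarrow> (real ^ 'n) set" where
  "half_open_cube c h = {x. \<forall>i. c $ i \<le> x $ i \<and> x $ i < c $ i + h}"

definition candidate_set :: "real \<Rightarrow> real \<Rightarrow> nat \<Rightarrow> (real ^ 'n) set \<Rightarrow> bool" where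
  "candidate_set \<alpha> \<rho> n C \<longleftrightarrow>
     (\<exists>P pt. partition_on UNIV P \<and>
        (\<forall>Q\<in>P. \<exists>c. Q = half_open_cube c (cube_side \<alpha> \<rho> n)) \<and>
        (\<forall>Q\<in>P. Q \<inter> annulus n \<noteq> {} \<longrightarrow> pt Q \<in> Q \<inter> annulus n) \<and>
        C = pt ` {Q \<in> P. Q \<inter> annulus n \<noteq> {}})"

text \<open>
  Every annulus contains finitely many candidates, so an ordering by annulus, arbitrary inside
  each one, is an enumeration by the natural numbers.
\<close>

definition candidate_ordering :: "(nat \<Rightarrow> (real ^ 'n) set) \<Rightarrow> (nat \<Rightarrow> real ^ 'n) \<Rightarrow> bool" where
  "candidate_ordering C c \<longleftrightarrow>
     bij_betw c UNIV (\<Union>n. C n) \<and>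
     (\<forall>i j m n. i < j \<longrightarrow> c i \<in> C m \<longrightarrow> c j \<in> C n \<longrightarrow> m \<le> n)"

definition selection_ball :: "real \<Rightarrow> real \<Rightarrow> real \<Rightarrow> real ^ 'n \<Rightarrow> (real ^ 'n) set" where
  "selection_ball \<alpha> a \<rho> \<xi> = {\<eta>. norm (\<eta> - \<xi>) < a * \<rho> * norm \<xi> powr (1 - \<alpha>)}"

fun retained :: "real \<Rightarrow> real \<Rightarrow> real \<Rightarrow> (nat \<Rightarrow> real ^ 'n) \<Rightarrow> nat \<Rightarrow> bool" where
  "retained \<alpha> a \<rho> c i \<longleftrightarrow>
     (\<forall>j\<in>{..<i}. retained \<alpha> a \<rho> c j \<longrightarrow>
        selection_ball \<alpha> a \<rho> (c i) \<inter> selection_ball \<alpha> a \<rho> (c j) = {})"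

declare retained.simps [simp del]

text \<open>
  \<open>subdyadic_centers \<alpha> a \<rho> \<xi>\<close>: some run of the selection procedure retains exactly the points
  \<open>\<xi> k\<close>, enumerated without repetition.
\<close>

definition subdyadic_centers :: "real \<Rightarrow> real \<Rightarrow> real \<Rightarrow> (nat \<Rightarrow> real ^ 'n) \<Rightarrow> bool" where
  "subdyadic_centers \<alpha> a \<rho> \<xi> \<longleftrightarrow>
     (\<exists>C c. (\<forall>n. candidate_set \<alpha> \<rho> n (C n)) \<and> candidate_ordering C c \<and>
        bij_betw \<xi> UNIV (c ` {i. retained \<alpha> a \<rho> c i}))"

definition lattice_node ::
    "real \<Rightarrow> real \<Rightarrow> real \<Rightarrow> (nat \<Rightarrow> real ^ 'n) \<Rightarrow> int ^ 'n \<Rightarrow> nat \<Rightarrow> real ^ 'n" where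
  "lattice_node \<alpha> b \<rho> \<xi> j k = (b * \<rho> * norm (\<xi> k) powr (\<alpha> - 1)) *\<^sub>R (\<chi> i. of_int (j $ i))"


section \<open>Subdyadic frame pairs and modulation spaces\<close>

text \<open>
  The constants \<open>\<rho>\<^sub>0\<close>, \<open>a\<close> and \<open>b\<close> are arbitrary positive numbers here; no upper bound on
  \<open>\<rho>\<^sub>0\<close> and \<open>a\<close> is imposed. The covering property of \<open>A\<close> is uniform over all lattices
  at scales up to \<open>\<rho>\<^sub>0\<close>; \<open>\<rho>\<close> is the scale of the lattice of the pair.
\<close>

definition subdyadic_frame_pair ::
    "real \<Rightarrow> real \<Rightarrow> real \<Rightarrow> real \<Rightarrow> real \<Rightarrow> real \<Rightarrow>
     (real ^ 'n \<Rightarrow> complex) \<Rightarrow> (nat \<Rightarrow> real ^ 'n) \<Rightarrow> bool" where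
  "subdyadic_frame_pair \<alpha> \<rho>\<^sub>0 a b A \<rho> \<phi> \<xi> \<longleftrightarrow>
     0 < \<rho>\<^sub>0 \<and> 0 < a \<and> 0 < b \<and> 1 < A \<and>
     (\<forall>r (\<zeta> :: nat \<Rightarrow> real ^ 'n). 0 < r \<longrightarrow> r \<le> \<rho>\<^sub>0 \<longrightarrow> subdyadic_centers \<alpha> a r \<zeta> \<longrightarrow>
        {\<eta>. 1 \<le> norm \<eta>} \<subseteq> (\<Union>k. {\<eta>. norm (\<eta> - \<zeta> k) \<le> A * r * norm (\<zeta> k) powr (1 - \<alpha>)})) \<and>
     schwartz \<phi> \<and> (\<forall>t. \<phi> t \<in> \<real>) \<and> (\<forall>t. \<phi> (- t) = \<phi> t) \<and>
     (LINT t|lborel. (cmod (\<phi> t))\<^sup>2) = 1 \<and>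
     smooth (fourier \<phi>) \<and> compact (support (fourier \<phi>)) \<and>
     0 < \<rho> \<and> \<rho> \<le> \<rho>\<^sub>0 \<and> subdyadic_centers \<alpha> a \<rho> \<xi> \<and>
     (\<exists>R\<^sub>0 R\<^sub>1 m\<^sub>0. 3 * 2 powr (max (\<alpha> - 1) 0) < R\<^sub>0 \<and> R\<^sub>0 < R\<^sub>1 \<and> 0 < m\<^sub>0 \<and>
        support (fourier \<phi>) \<subseteq> ball 0 R\<^sub>1 \<and>
        (\<forall>\<zeta>. norm \<zeta> \<le> R\<^sub>0 \<longrightarrow> m\<^sub>0 \<le> cmod (fourier \<phi> \<zeta>)) \<and>
        A * \<rho> < R\<^sub>0 \<and> b * \<rho> * R\<^sub>1 < pi)"

definition packet ::
    "real \<Rightarrow> (real ^ 'n \<Rightarrow> complex) \<Rightarrow> real ^ 'n \<Rightarrow> real ^ 'n \<Rightarrow> real ^ 'n \<Rightarrow> complex" where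
  "packet \<alpha> \<phi> x \<xi> t =
     complex_of_real (norm \<xi> powr (real CARD('n) / 2 * (1 - \<alpha>))) *
     \<phi> ((norm \<xi> powr (1 - \<alpha>)) *\<^sub>R (t - x)) * exp (\<i> * complex_of_real (t \<bullet> \<xi>))"

definition packet_coeff ::
    "real \<Rightarrow> real \<Rightarrow> real \<Rightarrow> (real ^ 'n \<Rightarrow> complex) \<Rightarrow> (nat \<Rightarrow> real ^ 'n) \<Rightarrow>
     ((real ^ 'n \<Rightarrow> complex) \<Rightarrow> complex) \<Rightarrow> int ^ 'n \<Rightarrow> nat \<Rightarrow> complex" where
  "packet_coeff \<alpha> b \<rho> \<phi> \<xi> f j k =
     distr_pairing f (packet \<alpha> \<phi> (lattice_node \<alpha> b \<rho> \<xi> j k) (\<xi> k))"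

text \<open>Only used for positive exponents \<open>r\<close>, where \<open>\<infinity>\<close> is mapped to \<open>\<infinity>\<close>.\<close>

definition ennpow :: "ennreal \<Rightarrow> real \<Rightarrow> ennreal" where
  "ennpow x r = (if x = \<infinity> then \<infinity> else ennreal (enn2real x powr r))"

definition lp_norm :: "ennreal \<Rightarrow> ('i \<Rightarrow> ennreal) \<Rightarrow> ennreal" where
  "lp_norm p g =
     (if p = \<infinity> then (SUP i. g i)
      else ennpow (\<Sum>\<^sub>\<infinity>i. ennpow (g i) (enn2real p)) (1 / enn2real p))"

definition modulation_norm ::
    "real \<Rightarrow> real \<Rightarrow> real \<Rightarrow> (real ^ 'n \<Rightarrow> complex) \<Rightarrow> (nat \<Rightarrow> real ^ 'n) \<Rightarrow>
     real \<Rightarrow> ennreal \<Rightarrow> ennreal \<Rightarrow> ((real ^ 'n \<Rightarrow> complex) \<Rightarrow> complex) \<Rightarrow> ennreal" where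
  "modulation_norm \<alpha> b \<rho> \<phi> \<xi> \<beta> p q f =
     lp_norm q (\<lambda>k. lp_norm p (\<lambda>j. ennreal (cmod (packet_coeff \<alpha> b \<rho> \<phi> \<xi> f j k))) *
                    ennreal ((1 + norm (\<xi> k)) powr \<beta>))"

definition modulation_space ::
    "real \<Rightarrow> real \<Rightarrow> real \<Rightarrow> (real ^ 'n \<Rightarrow> complex) \<Rightarrow> (nat \<Rightarrow> real ^ 'n) \<Rightarrow>
     real \<Rightarrow> ennreal \<Rightarrow> ennreal \<Rightarrow> ((real ^ 'n \<Rightarrow> complex) \<Rightarrow> complex) set" where
  "modulation_space \<alpha> b \<rho> \<phi> \<xi> \<beta> p q =
     {f. tempered_distribution f \<and> modulation_norm \<alpha> b \<rho> \<phi> \<xi> \<beta> p q f < \<infinity>}"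

end

theory Submission
  imports Defs
begin

text \<open>Both norms are mixed sequence norms of the same packet coefficients with the same
  weights, so the embedding reduces to the nesting of \<open>\<ell>^p\<close> spaces with constant
  1. For finite exponents r \<le> s, let N be the r-norm of g. Each entry is at most N, so g_i^s =
  g_i^r g_i^(s-r) \<le> g_i^r N^(s-r); summing gives N^s on the right
  (\<open>lp_norm_antimono\<close>). Nesting in the outer exponent and then, by monotonicity of the
  outer norm, in the inner one yields \<open>modulation_norm_antimono\<close>. Norms take values in
  [0, \<infinity>], so infinite norms go through the same computation.\<close>

lemma ennpow_mono:
  assumes "x \<le> y" "0 \<le> r"
  shows "ennpow x r \<le> ennpow y r"
  using assms unfolding ennpow_def
  by (auto simp: top_unique less_top intro!: ennreal_leI powr_mono2 enn2real_mono)

lemma ennpow_ennpow: "ennpow (ennpow x r) s = ennpow x (r * s)"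
  by (simp add: ennpow_def powr_powr)

text \<open>The endpoints are consistent for all real exponents: \<open>ennpow\<close> fixes
  \<infinity>, and 0 \<open>powr\<close> anything is 0, even for exponent 0.\<close>

lemma ennpow_add: "ennpow x (r + s) = ennpow x r * ennpow x s"
  by (simp add: ennpow_def powr_add ennreal_mult ennreal_top_mult)

lemma ennpow_one: "ennpow x 1 = x"
  by (simp add: ennpow_def less_top)

lemma ennpow_inverse_cancel:
  assumes "0 < r"
  shows "ennpow (ennpow x r) (1 / r) = x" "ennpow (ennpow x (1 / r)) r = x"
  using assms by (simp_all add: ennpow_ennpow ennpow_one)

lemma infsum_mono_ennreal:
  fixes f g :: "'i \<Rightarrow> ennreal"
  assumes "\<And>i. f i \<le> g i"
  shows "(\<Sum>\<^sub>\<infinity>i. f i) \<le> (\<Sum>\<^sub>\<infinity>i. g i)"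
  by (intro infsum_mono nonneg_summable_on_complete assms) auto

lemma le_infsum_ennreal:
  fixes f :: "'i \<Rightarrow> ennreal"
  shows "f i \<le> (\<Sum>\<^sub>\<infinity>i. f i)"
proof -
  have "sum f {i} \<le> (\<Sum>\<^sub>\<infinity>i. f i)"
    unfolding nonneg_infsum_complete[of UNIV f, simplified] by (rule SUP_upper) simp
  then show ?thesis by simp
qed

text \<open>The sum is the supremum of its finite partial sums, and multiplication by a constant
  commutes with suprema, also for c = \<infinity>.\<close>

lemma infsum_cmult_right_ennreal:
  fixes f :: "'i \<Rightarrow> ennreal"
  shows "(\<Sum>\<^sub>\<infinity>i. f i * c) = (\<Sum>\<^sub>\<infinity>i. f i) * c"
  by (simp add: nonneg_infsum_complete SUP_mult_right_ennreal flip: sum_distrib_right)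

lemma enn2real_ge_1:
  assumes "1 \<le> p" "p \<noteq> (\<infinity>::ennreal)"
  shows "1 \<le> enn2real p"
  using enn2real_mono[OF assms(1)] assms(2) by (simp add: less_top)

lemma lp_norm_mono:
  assumes "1 \<le> p" "\<And>i. f i \<le> g i"
  shows "lp_norm p f \<le> lp_norm p g"
proof (cases "p = \<infinity>")
  case True
  then show ?thesis by (auto simp: lp_norm_def intro: SUP_mono' assms)
next
  case False
  then show ?thesis using enn2real_ge_1[OF assms(1)]
    by (auto simp: lp_norm_def intro!: ennpow_mono infsum_mono_ennreal assms)
qed

text \<open>For finite p, a single term of a nonnegative sum is at most the sum. This is the nesting
  into the sup norm, and it also supplies the bound g_i \<le> N for finite exponents.\<close>

lemma le_lp_norm:
  assumes "1 \<le> p"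
  shows "g i \<le> lp_norm p g"
proof (cases "p = \<infinity>")
  case True
  then show ?thesis by (auto simp: lp_norm_def intro: SUP_upper)
next
  case False
  define r where "r = enn2real p"
  have r: "1 \<le> r" using enn2real_ge_1[OF assms False] by (simp add: r_def)
  have "g i = ennpow (ennpow (g i) r) (1 / r)"
    using r by (simp add: ennpow_inverse_cancel)
  also have "\<dots> \<le> ennpow (\<Sum>\<^sub>\<infinity>i. ennpow (g i) r) (1 / r)"
    using r by (intro ennpow_mono le_infsum_ennreal) auto
  finally show ?thesis using False by (simp add: lp_norm_def r_def)
qed

lemma lp_norm_antimono:
  assumes "1 \<le> p" "p \<le> q"
  shows "lp_norm q g \<le> lp_norm p g"
proof (cases "q = \<infinity>")
  case True
  then have "lp_norm q g = (SUP i. g i)" by (simp add: lp_norm_def)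
  also have "\<dots> \<le> lp_norm p g" by (intro SUP_least le_lp_norm assms)
  finally show ?thesis .
next
  case False
  with assms have p: "p \<noteq> \<infinity>" by (auto simp: top_unique)
  define r s N where "r = enn2real p" and "s = enn2real q" and "N = lp_norm p g"
  have r: "1 \<le> r" using enn2real_ge_1[OF assms(1) p] by (simp add: r_def)
  have rs: "r \<le> s" using assms False by (simp add: r_def s_def enn2real_mono less_top)
  have N: "ennpow N r = (\<Sum>\<^sub>\<infinity>i. ennpow (g i) r)"
    using p r by (simp add: N_def lp_norm_def ennpow_inverse_cancel flip: r_def)
  \<comment> \<open>The case s = r is included: there \<open>ennpow N 0\<close> is 0 when N = 0, but
    then g i = 0 as well.\<close>
  have "ennpow (g i) s \<le> ennpow (g i) r * ennpow N (s - r)" for i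
    using ennpow_add[of "g i" r "s - r"] ennpow_mono[OF le_lp_norm[OF assms(1)], of "s - r" g i] rs
    by (simp add: mult_left_mono flip: N_def)
  then have "(\<Sum>\<^sub>\<infinity>i. ennpow (g i) s) \<le> (\<Sum>\<^sub>\<infinity>i. ennpow (g i) r * ennpow N (s - r))"
    by (rule infsum_mono_ennreal)
  \<comment> \<open>The constant N^(s-r) leaves the sum, what remains is N^r by the fact
    \<open>N\<close>, and the exponents add up to s.\<close>
  also have "\<dots> = ennpow N s"
    using ennpow_add[of N r "s - r"] by (simp add: infsum_cmult_right_ennreal N)
  finally have "ennpow (\<Sum>\<^sub>\<infinity>i. ennpow (g i) s) (1 / s) \<le> ennpow (ennpow N s) (1 / s)"
    using r rs by (intro ennpow_mono) auto
  also have "\<dots> = N" using r rs by (intro ennpow_inverse_cancel) simp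
  finally show ?thesis using False by (simp add: lp_norm_def s_def N_def)
qed

text \<open>The comparison passes through the exponents \<open>(p\<^sub>2, q\<^sub>1)\<close>:
  lowering q first leaves both sides with one outer norm, so the inner norms can be compared for
  each k, the nonnegative weight preserving the order.\<close>

lemma modulation_norm_antimono:
  assumes "1 \<le> p\<^sub>1" "p\<^sub>1 \<le> p\<^sub>2" "1 \<le> q\<^sub>1" "q\<^sub>1 \<le> q\<^sub>2"
  shows "modulation_norm \<alpha> b \<rho> \<phi> \<xi> \<beta> p\<^sub>2 q\<^sub>2 f \<le> modulation_norm \<alpha> b \<rho> \<phi> \<xi> \<beta> p\<^sub>1 q\<^sub>1 f"
proof -
  have "modulation_norm \<alpha> b \<rho> \<phi> \<xi> \<beta> p\<^sub>2 q\<^sub>2 f \<le> modulation_norm \<alpha> b \<rho> \<phi> \<xi> \<beta> p\<^sub>2 q\<^sub>1 f"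
    unfolding modulation_norm_def by (rule lp_norm_antimono[OF assms(3,4)])
  also have "\<dots> \<le> modulation_norm \<alpha> b \<rho> \<phi> \<xi> \<beta> p\<^sub>1 q\<^sub>1 f"
    unfolding modulation_norm_def
    by (intro lp_norm_mono[OF assms(3)] mult_right_mono lp_norm_antimono[OF assms(1,2)]) simp
  finally show ?thesis .
qed

theorem proposition4p12:
  fixes \<alpha> \<beta> \<rho>\<^sub>0 a b A \<rho> :: real
    and \<phi> :: "real ^ 'n \<Rightarrow> complex"
    and \<xi> :: "nat \<Rightarrow> real ^ 'n"
    and p\<^sub>1 p\<^sub>2 q\<^sub>1 q\<^sub>2 :: ennreal
  assumes "\<alpha> > 0"
    and "subdyadic_frame_pair \<alpha> \<rho>\<^sub>0 a b A \<rho> \<phi> \<xi>"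
    and "1 \<le> p\<^sub>1" "p\<^sub>1 \<le> p\<^sub>2"
    and "1 \<le> q\<^sub>1" "q\<^sub>1 \<le> q\<^sub>2"
  shows "modulation_space \<alpha> b \<rho> \<phi> \<xi> \<beta> p\<^sub>1 q\<^sub>1 \<subseteq> modulation_space \<alpha> b \<rho> \<phi> \<xi> \<beta> p\<^sub>2 q\<^sub>2 \<and>
    (\<exists>K::real. K > 0 \<and> (\<forall>f \<in> modulation_space \<alpha> b \<rho> \<phi> \<xi> \<beta> p\<^sub>1 q\<^sub>1.
       modulation_norm \<alpha> b \<rho> \<phi> \<xi> \<beta> p\<^sub>2 q\<^sub>2 f \<le> ennreal K * modulation_norm \<alpha> b \<rho> \<phi> \<xi> \<beta> p\<^sub>1 q\<^sub>1 f))"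
proof -
  note le = modulation_norm_antimono[OF assms(3-6)]
  show ?thesis
  \<comment> \<open>K = 1 works because sequence-space nesting costs no constant; the same
    inequality transfers finiteness of the norm and hence membership.\<close>
  proof (intro conjI exI[of _ 1] ballI subsetI)
    fix f assume "f \<in> modulation_space \<alpha> b \<rho> \<phi> \<xi> \<beta> p\<^sub>1 q\<^sub>1"
    then show "f \<in> modulation_space \<alpha> b \<rho> \<phi> \<xi> \<beta> p\<^sub>2 q\<^sub>2"
      unfolding modulation_space_def using le_less_trans[OF le] by blast
  qed (simp_all add: le)
qed

end
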